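(* Let $D$ be the formal derivative on $\mathbb Q[t,u,v]$ with respect to the grammar $\{t\rightarrow t^2v,\ u\rightarrow 2tuv,\ v\rightarrow 4tu\}$, i.e. the $\mathbb Q$-linear derivation with $D(t)=t^2v$, $D(u)=2tuv$, $D(v)=4tu$. Then for every $n\ge1$, $$D^n\!\left(\frac{v}{2}\right)=(n+1)!\,t^n\,M_{n-1}(u;v),$$ where $M_m(u;v)=\sum_{k=0}^{\lfloor m/2\rfloor}\binom{m}{2k}C_k u^{k+1}v^{m-2k}$ and $C_k=\frac{1}{k+1}\binom{2k}{k}$.
   Context: A formal derivative with respect to a grammar (a set of substitution rules $z\to f_z$ for variables $z$) is the linear operator $D$ satisfying $D(z)=f_z$, $D(uv)=D(u)v+uD(v)$ and $D(c)=0$ for constants. *)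

theory Defs
  imports Complex_Main "HOL-Library.Poly_Mapping"
begin

text \<open>
  The polynomial ring over the rationals in the variables \<^typ>\<open>'x\<close>: a monomial is a finitely
  supported exponent function, a polynomial a finitely supported map from monomials to
  coefficients; multiplication is the convolution product of the library.
\<close>

type_synonym 'x rat_mpoly = "('x \<Rightarrow>\<^sub>0 nat) \<Rightarrow>\<^sub>0 rat"

definition Const :: "rat \<Rightarrow> 'x rat_mpoly"
  where "Const c = Poly_Mapping.single 0 c"

definition Var :: "'x \<Rightarrow> 'x rat_mpoly"
  where "Var x = Poly_Mapping.single (Poly_Mapping.single x 1) 1"

text \<open>
  A grammar \<open>G\<close> assigns to each variable the polynomial that is substituted for it.
\<close>

definition formal_derivative :: "('x \<Rightarrow> 'x rat_mpoly) \<Rightarrow> ('x rat_mpoly \<Rightarrow> 'x rat_mpoly) \<Rightarrow> bool"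
  where "formal_derivative G D \<longleftrightarrow>
    (\<forall>p q. D (p + q) = D p + D q) \<and>
    (\<forall>c p. D (Const c * p) = Const c * D p) \<and>
    (\<forall>x. D (Var x) = G x) \<and>
    (\<forall>p q. D (p * q) = D p * q + p * D q) \<and>
    (\<forall>c. D (Const c) = 0)"

datatype tuv = T | U | V

fun grammar :: "tuv \<Rightarrow> tuv rat_mpoly" where
  "grammar T = (Var T)\<^sup>2 * Var V"
| "grammar U = 2 * Var T * Var U * Var V"
| "grammar V = 4 * Var T * Var U"

definition catalan :: "nat \<Rightarrow> rat"
  where "catalan k = 1 / (of_nat k + 1) * of_nat ((2 * k) choose k)"

definition M :: "nat \<Rightarrow> 'x rat_mpoly \<Rightarrow> 'x rat_mpoly \<Rightarrow> 'x rat_mpoly"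
  where "M m u v =
    (\<Sum>k=0..m div 2. of_nat (m choose (2 * k)) * Const (catalan k) * u ^ (k + 1) * v ^ (m - 2 * k))"

text \<open>
  The lemmas below show that, over finitely many variables, the conditions of
  \<open>formal_derivative\<close> determine \<open>D\<close> uniquely and are always satisfiable.
\<close>

lemma rat_mpoly_induct [case_names zero single add]:
  fixes p :: "'a \<Rightarrow>\<^sub>0 'b::comm_monoid_add"
  assumes "P 0" "\<And>m a. P (Poly_Mapping.single m a)" "\<And>p q. P p \<Longrightarrow> P q \<Longrightarrow> P (p + q)"
  shows "P p"
proof (induction p rule: update_induct)
  case const
  show ?case by (fact assms(1))
next
  case (update f a b)
  have "Poly_Mapping.update a b f = f + Poly_Mapping.single a b"
    using update(1)
    by (intro poly_mapping_eqI) (auto simp: lookup_update lookup_add lookup_single in_keys_iff when_def)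
  then show ?case using update(3) assms(2,3) by simp
qed

definition deriv_monom :: "('x::finite \<Rightarrow> 'x rat_mpoly) \<Rightarrow> ('x \<Rightarrow>\<^sub>0 nat) \<Rightarrow> rat \<Rightarrow> 'x rat_mpoly"
  where "deriv_monom G m a =
    (\<Sum>x\<in>UNIV. Poly_Mapping.single (m - Poly_Mapping.single x 1)
                 (a * of_nat (Poly_Mapping.lookup m x)) * G x)"

definition deriv_poly :: "('x::finite \<Rightarrow> 'x rat_mpoly) \<Rightarrow> 'x rat_mpoly \<Rightarrow> 'x rat_mpoly"
  where "deriv_poly G p = (\<Sum>m\<in>Poly_Mapping.keys p. deriv_monom G m (Poly_Mapping.lookup p m))"

lemma deriv_monom_add: "deriv_monom G m (a + b) = deriv_monom G m a + deriv_monom G m b"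
  by (simp add: deriv_monom_def distrib_right single_add sum.distrib)

lemma deriv_monom_0 [simp]: "deriv_monom G m 0 = 0"
  by (simp add: deriv_monom_def)

lemma deriv_poly_superset:
  assumes "finite A" "Poly_Mapping.keys p \<subseteq> A"
  shows "deriv_poly G p = (\<Sum>m\<in>A. deriv_monom G m (Poly_Mapping.lookup p m))"
  unfolding deriv_poly_def using assms
  by (intro sum.mono_neutral_left) (auto simp: in_keys_iff)

lemma deriv_poly_add: "deriv_poly G (p + q) = deriv_poly G p + deriv_poly G q"
proof -
  let ?A = "Poly_Mapping.keys p \<union> Poly_Mapping.keys q"
  have "Poly_Mapping.keys (p + q) \<subseteq> ?A" by (rule keys_add)
  then show ?thesis
    by (simp add: deriv_poly_superset[of ?A] lookup_add deriv_monom_add sum.distrib)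
qed

lemma deriv_poly_single: "deriv_poly G (Poly_Mapping.single m a) = deriv_monom G m a"
  by (simp add: deriv_poly_def)

lemma deriv_monom_mult:
  "deriv_monom G (m + n) (a * b) =
     deriv_monom G m a * Poly_Mapping.single n b + Poly_Mapping.single m a * deriv_monom G n b"
proof -
  have l: "Poly_Mapping.single (k - Poly_Mapping.single x 1 + l) (c * of_nat (Poly_Mapping.lookup k x))
         = Poly_Mapping.single (k + l - Poly_Mapping.single x 1) (c * of_nat (Poly_Mapping.lookup k x))"
    for k l :: "'a \<Rightarrow>\<^sub>0 nat" and x and c :: rat
  proof (cases "Poly_Mapping.lookup k x = 0")
    case False
    then have "k - Poly_Mapping.single x 1 + l = k + l - Poly_Mapping.single x 1"
      by (intro poly_mapping_eqI) (auto simp: lookup_add lookup_minus lookup_single when_def)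
    then show ?thesis by simp
  qed simp
  have "Poly_Mapping.single (m + n - Poly_Mapping.single x 1)
          (a * b * of_nat (Poly_Mapping.lookup (m + n) x)) * G x
      = Poly_Mapping.single (m - Poly_Mapping.single x 1) (a * of_nat (Poly_Mapping.lookup m x)) * G x
          * Poly_Mapping.single n b
        + Poly_Mapping.single m a *
          (Poly_Mapping.single (n - Poly_Mapping.single x 1) (b * of_nat (Poly_Mapping.lookup n x)) * G x)"
    for x
  proof -
    have "Poly_Mapping.single (m - Poly_Mapping.single x 1) (a * of_nat (Poly_Mapping.lookup m x))
            * Poly_Mapping.single n b
        = Poly_Mapping.single (m + n - Poly_Mapping.single x 1) (a * b * of_nat (Poly_Mapping.lookup m x))"
      using l[of m x n "a * b"] by (simp add: mult_single algebra_simps)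
    moreover have "Poly_Mapping.single m a *
          Poly_Mapping.single (n - Poly_Mapping.single x 1) (b * of_nat (Poly_Mapping.lookup n x))
        = Poly_Mapping.single (m + n - Poly_Mapping.single x 1) (a * b * of_nat (Poly_Mapping.lookup n x))"
      using l[of n x m "a * b"] by (simp add: mult_single algebra_simps)
    ultimately show ?thesis
      by (simp add: lookup_add distrib_left single_add distrib_right
          flip: mult.assoc) (simp add: mult.assoc mult.left_commute mult.commute)
  qed
  then show ?thesis
    by (simp add: deriv_monom_def sum_distrib_left sum_distrib_right sum.distrib)
qed

lemma deriv_poly_mult: "deriv_poly G (p * q) = deriv_poly G p * q + p * deriv_poly G q"
proof (induction p rule: rat_mpoly_induct)
  case zero
  show ?case by (simp add: deriv_poly_def)
next
  case (single m a)
  show ?case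
  proof (induction q rule: rat_mpoly_induct)
    case zero
    show ?case by (simp add: deriv_poly_def)
  next
    case (single n b)
    show ?case by (simp add: mult_single deriv_poly_single deriv_monom_mult)
  next
    case (add p q)
    then show ?case by (simp add: distrib_left deriv_poly_add add_ac)
  qed
next
  case (add p p')
  then show ?case by (simp add: distrib_right deriv_poly_add add_ac)
qed

lemma formal_derivative_deriv_poly: "formal_derivative G (deriv_poly G)"
proof -
  have c: "deriv_poly G (Const c) = 0" for c
    by (simp add: Const_def deriv_poly_single deriv_monom_def)
  have "deriv_poly G (Var x) = G x" for x
  proof -
    have "deriv_poly G (Var x) = (\<Sum>y\<in>UNIV. if y = x then G x else 0)"
      unfolding Var_def deriv_poly_single deriv_monom_def
      by (intro sum.cong) (auto simp: lookup_single when_def)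
    then show ?thesis by simp
  qed
  with c show ?thesis
    by (simp add: formal_derivative_def deriv_poly_add deriv_poly_mult)
qed

lemma formal_derivative_unique:
  assumes "formal_derivative G D" "formal_derivative G D'"
  shows "D p = D' p"
proof -
  note d = assms[unfolded formal_derivative_def]
  have pow: "D (Poly_Mapping.single (Poly_Mapping.single x k) 1)
      = D' (Poly_Mapping.single (Poly_Mapping.single x k) 1)" for x k
  proof (induction k)
    case 0
    then show ?case using d by (metis Const_def single_zero)
  next
    case (Suc k)
    have "Poly_Mapping.single (Poly_Mapping.single x (Suc k)) 1
        = Var x * Poly_Mapping.single (Poly_Mapping.single x k) 1"
      by (simp add: Var_def mult_single flip: single_add)
    then show ?case using Suc d by metis
  qed
  have mon: "D (Poly_Mapping.single m 1) = D' (Poly_Mapping.single m 1)" for m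
  proof (induction m rule: rat_mpoly_induct)
    case zero
    then show ?case using d by (metis Const_def)
  next
    case (single x k)
    show ?case by (rule pow)
  next
    case (add m n)
    have "Poly_Mapping.single (m + n) (1::rat) = Poly_Mapping.single m 1 * Poly_Mapping.single n 1"
      by (simp add: mult_single)
    then show ?case using add d by metis
  qed
  show ?thesis
  proof (induction p rule: rat_mpoly_induct)
    case zero
    then show ?case using d by (metis Const_def single_zero)
  next
    case (single m a)
    have "Poly_Mapping.single m a = Const a * Poly_Mapping.single m 1"
      by (simp add: Const_def mult_single)
    then show ?case using mon d by metis
  next
    case (add p q)
    then show ?case using d by metis
  qed
qed

lemma ex1_formal_derivative:
  fixes G :: "'x::finite \<Rightarrow> 'x rat_mpoly"
  shows "\<exists>!D. formal_derivative G D"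
  using formal_derivative_deriv_poly formal_derivative_unique by blast

instance tuv :: finite
proof
  have "(UNIV :: tuv set) = {T, U, V}"
    using tuv.exhaust by blast
  then show "finite (UNIV :: tuv set)" by (metis finite.emptyI finite.insertI)
qed

end

theory Submission
  imports Defs
begin

text \<open>
  On the monomial \<open>t\<^sup>m\<^sup>+\<^sup>1 u\<^sup>k\<^sup>+\<^sup>1 v\<^sup>m\<^sup>-\<^sup>2\<^sup>k\<close> the derivation gives
  \<open>t\<^sup>m\<^sup>+\<^sup>2 ((m + 3 + 2k) u\<^sup>k\<^sup>+\<^sup>1 v\<^sup>m\<^sup>+\<^sup>1\<^sup>-\<^sup>2\<^sup>k + 4 (m - 2k) u\<^sup>k\<^sup>+\<^sup>2 v\<^sup>m\<^sup>-\<^sup>1\<^sup>-\<^sup>2\<^sup>k)\<close>.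
  Hence \<open>D (t\<^sup>m\<^sup>+\<^sup>1 M\<^sub>m) = (m + 3) t\<^sup>m\<^sup>+\<^sup>2 M\<^sub>m\<^sub>+\<^sub>1\<close> amounts to a recurrence for the coefficients
  of \<open>M\<^sub>m\<close>, and the theorem follows by induction.
\<close>

lemma Const_0 [simp]: "Const 0 = 0"
  by (simp add: Const_def)

lemma Const_1 [simp]: "Const 1 = 1"
  by (simp add: Const_def)

lemma Const_add: "Const (a + b) = Const a + Const b"
  by (simp add: Const_def single_add)

lemma Const_mult: "Const (a * b) = Const a * Const b"
  by (simp add: Const_def mult_single)

lemma Const_of_nat [simp]: "Const (of_nat n) = of_nat n"
  by (induction n) (simp_all add: Const_add)

lemma Const_numeral [simp]: "Const (numeral n) = numeral n"
  using Const_of_nat[of "numeral n"] by simp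

lemma Const_fact: "Const (fact n) = fact n"
  by (metis Const_of_nat of_nat_fact)

context
  fixes G :: "'x \<Rightarrow> 'x rat_mpoly" and D
  assumes D: "formal_derivative G D"
begin

lemma formal_derivative_add: "D (p + q) = D p + D q"
  using D by (simp add: formal_derivative_def)

lemma formal_derivative_mult: "D (p * q) = D p * q + p * D q"
  using D unfolding formal_derivative_def by blast

lemma formal_derivative_Const: "D (Const c) = 0"
  using D by (simp add: formal_derivative_def)

lemma formal_derivative_Const_mult: "D (Const c * p) = Const c * D p"
  using D unfolding formal_derivative_def by blast

lemma formal_derivative_Var: "D (Var x) = G x"
  using D by (simp add: formal_derivative_def)

lemma formal_derivative_sum: "D (\<Sum>i\<in>A. f i) = (\<Sum>i\<in>A. D (f i))"
  \<comment> \<open>The constant rule at 0 gives \<open>D 0 = 0\<close>, which covers both the empty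
    and the infinite index set.\<close>
  using formal_derivative_Const[of 0]
  by (induction A rule: infinite_finite_induct) (simp_all add: formal_derivative_add)

lemma formal_derivative_power: "D (p ^ n) = of_nat n * p ^ (n - 1) * D p"
proof (induction n)
  case 0
  then show ?case using formal_derivative_Const[of 1] by simp
next
  case (Suc n)
  have "p * D (p ^ n) = of_nat n * p ^ n * D p"
    unfolding Suc by (cases n) (simp_all add: mult_ac)
  then show ?case by (simp add: formal_derivative_mult algebra_simps)
qed

end

text \<open>Two absorption identities relate the central binomial coefficients for k + 1 and k.
  Clearing the denominators in \<open>catalan\<close> then leaves a common factor
  \<open>Suc k\<close>, which is cancelled.\<close>

lemma catalan_Suc: "of_nat (k + 2) * catalan (Suc k) = 2 * of_nat (2 * k + 1) * catalan k"
proof -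
  have "Suc k * ((2 * Suc k) choose Suc k) = Suc k * (2 * (Suc (2 * k) choose k))"
    using binomial_absorption[of k "2 * Suc k"] by (simp del: binomial_Suc_Suc)
  also have "\<dots> = 2 * (Suc k * (Suc (2 * k) choose k))"
    by (simp only: mult_ac)
  also have "Suc k * (Suc (2 * k) choose k) = Suc (2 * k) * ((2 * k) choose k)"
    using binomial_absorb_comp[of "Suc (2 * k)" k] by simp
  finally have "Suc k * ((2 * Suc k) choose Suc k) = 2 * Suc (2 * k) * ((2 * k) choose k)"
    by (simp only: mult.assoc)
  from arg_cong[OF this, of of_nat]
  have "of_nat (Suc k) * of_nat ((2 * Suc k) choose Suc k)
      = 2 * of_nat (Suc (2 * k)) * (of_nat ((2 * k) choose k) :: rat)"
    by (simp only: of_nat_mult of_nat_numeral)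
  moreover have "of_nat (Suc k) * (of_nat (k + 2) * catalan (Suc k))
      = of_nat (Suc k) * of_nat ((2 * Suc k) choose Suc k)"
    unfolding catalan_def by (simp add: field_simps del: binomial_Suc_Suc)
  moreover have "of_nat ((2 * k) choose k) = of_nat (Suc k) * catalan k"
    unfolding catalan_def by (simp add: field_simps)
  ultimately have "of_nat (Suc k) * (of_nat (k + 2) * catalan (Suc k))
      = of_nat (Suc k) * (2 * of_nat (2 * k + 1) * catalan k)"
    by (simp only: mult_ac Suc_eq_plus1)
  then show ?thesis
    unfolding mult_cancel_left of_nat_eq_0_iff by simp
qed

definition M_coeff :: "nat \<Rightarrow> nat \<Rightarrow> rat"
  where "M_coeff m k = of_nat (m choose (2 * k)) * catalan k"

lemma M_coeff_eq_0: "m < 2 * k \<Longrightarrow> M_coeff m k = 0"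
  by (simp add: M_coeff_def)

lemma M_coeff_0 [simp]: "M_coeff m 0 = 1"
  by (simp add: M_coeff_def catalan_def)

text \<open>The added terms vanish because their binomial coefficient is zero. Without the bound
  \<open>m div 2\<close>, sums for m and m + 1 can be shifted and compared with no case split on
  parity.\<close>

lemma M_eq_sum_M_coeff:
  assumes "m \<le> n"
  shows "M m u v = (\<Sum>k\<le>n. Const (M_coeff m k) * u ^ (k + 1) * v ^ (m - 2 * k))"
proof -
  have "M m u v = (\<Sum>k=0..m div 2. Const (M_coeff m k) * u ^ (k + 1) * v ^ (m - 2 * k))"
    by (simp add: M_def M_coeff_def Const_mult)
  also have "\<dots> = (\<Sum>k\<le>n. Const (M_coeff m k) * u ^ (k + 1) * v ^ (m - 2 * k))"
    using assms by (intro sum.mono_neutral_left) (auto simp: M_coeff_eq_0)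
  finally show ?thesis .
qed

text \<open>This compares the coefficients of u^(k+2) v^(m-1-2k). Pascal's rule splits the left
  side, and \<open>catalan_Suc\<close> expresses C_k through C_(k+1), so only a relation between
  neighbouring binomial coefficients remains.\<close>

lemma M_coeff_Suc_Suc:
  "of_nat (m + 3) * M_coeff (Suc m) (Suc k)
    = of_nat (m + 5 + 2 * k) * M_coeff m (Suc k) + of_nat (4 * (m - 2 * k)) * M_coeff m k"
proof -
  \<comment> \<open>Both sides equal m * ((m - 1) choose j).\<close>
  have absorb: "Suc j * (m choose Suc j) = (m - j) * (m choose j)" for j
    by (metis binomial_absorption binomial_absorb_comp)
  define x y z :: rat where
    "x = of_nat (m choose (2 * k))" and
    "y = of_nat (m choose (2 * k + 1))" and
    "z = of_nat (m choose (2 * k + 2))"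
  have xy: "of_nat (m - 2 * k) * x = of_nat (2 * k + 1) * y"
    unfolding x_def y_def using absorb[of "2 * k"]
    by (metis Suc_eq_plus1 of_nat_mult)
  have "of_nat (2 * k + 2) * z = of_nat (m - (2 * k + 1)) * y"
    unfolding z_def y_def using absorb[of "2 * k + 1"]
    by (metis add_2_eq_Suc' Suc_eq_plus1 of_nat_mult)
  \<comment> \<open>Truncated subtraction may be replaced by rational subtraction: if m < 2k + 1,
    then y = 0.\<close>
  also have "\<dots> = (of_nat m - of_nat (2 * k + 1)) * y"
    by (cases "2 * k + 1 \<le> m") (auto simp: y_def)
  finally have yz: "of_nat (2 * k + 2) * z = (of_nat m - of_nat (2 * k + 1)) * y" .
  have coeff: "M_coeff (Suc m) (Suc k) = (y + z) * catalan (Suc k)"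
      "M_coeff m (Suc k) = z * catalan (Suc k)" "M_coeff m k = x * catalan k"
    by (simp_all add: M_coeff_def x_def y_def z_def)
  have "of_nat (4 * (m - 2 * k)) * (x * catalan k)
      = 4 * (of_nat (m - 2 * k) * x) * catalan k"
    by simp
  also have "\<dots> = 2 * y * (2 * of_nat (2 * k + 1) * catalan k)"
    unfolding xy by simp
  also have "\<dots> = 2 * y * (of_nat (k + 2) * catalan (Suc k))"
    unfolding catalan_Suc ..
  finally have *: "of_nat (4 * (m - 2 * k)) * (x * catalan k)
      = 2 * y * (of_nat (k + 2) * catalan (Suc k))" .
  \<comment> \<open>Collecting y and z turns this into (m - 2k - 1) y = (2k + 2) z, which is
    \<open>yz\<close>.\<close>
  have "of_nat (m + 3) * (y + z) = of_nat (m + 5 + 2 * k) * z + 2 * y * of_nat (k + 2)"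
    using yz by (simp add: algebra_simps)
  then have "of_nat (m + 3) * (y + z) * catalan (Suc k)
      = (of_nat (m + 5 + 2 * k) * z + 2 * y * of_nat (k + 2)) * catalan (Suc k)"
    by simp
  then show ?thesis
    unfolding coeff * by (simp only: distrib_right mult.assoc)
qed

context
  fixes D :: "tuv rat_mpoly \<Rightarrow> tuv rat_mpoly"
  assumes D: "formal_derivative grammar D"
begin

text \<open>Each factor t reproduces itself times tv and each factor u itself times 2tv, whence i +
  2j; each factor v is traded for 4tu. For l = 0 the coefficient 4l hides the truncated exponent
  \<open>l - 1\<close>.\<close>

lemma D_monomial:
  "D (Var T ^ i * (Var U ^ j * Var V ^ l))
    = Var T ^ (i + 1) * (of_nat (i + 2 * j) * Var U ^ j * Var V ^ (l + 1)
        + of_nat (4 * l) * Var U ^ (j + 1) * Var V ^ (l - 1))"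
proof -
  have "D (Var T ^ i) = of_nat i * Var T ^ (i + 1) * Var V"
    unfolding formal_derivative_power[OF D] formal_derivative_Var[OF D]
    by (cases i) (simp_all add: power2_eq_square mult_ac)
  moreover have "D (Var U ^ j) = of_nat (2 * j) * Var T * Var U ^ j * Var V"
    unfolding formal_derivative_power[OF D] formal_derivative_Var[OF D]
    by (cases j) (simp_all add: algebra_simps)
  moreover have "D (Var V ^ l) = of_nat (4 * l) * Var T * Var U * Var V ^ (l - 1)"
    unfolding formal_derivative_power[OF D] formal_derivative_Var[OF D]
    by (simp add: mult_ac)
  ultimately show ?thesis
    by (simp add: formal_derivative_mult[OF D] algebra_simps)
qed

lemma D_power_times_M:
  "D (Var T ^ (m + 1) * M m (Var U) (Var V))
    = of_nat (m + 3) * Var T ^ (m + 2) * M (m + 1) (Var U) (Var V)"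
proof -
  let ?u = "Var U" and ?v = "Var V" and ?t = "Var T ^ (m + 2)"
  \<comment> \<open>\<open>f\<close> collects the terms where D hits t or u, \<open>g\<close> those
    where it hits v; \<open>h\<close> will be the terms of the target sum.\<close>
  define f g where
    "f k = Const (of_nat (m + 3 + 2 * k) * M_coeff m k) * ?u ^ (k + 1) * ?v ^ (m + 1 - 2 * k)" and
    "g k = Const (of_nat (4 * (m - 2 * k)) * M_coeff m k) * ?u ^ (k + 2) * ?v ^ (m - 2 * k - 1)"
    for k
  define h where
    "h k = Const (of_nat (m + 3) * M_coeff (m + 1) k) * ?u ^ (k + 1) * ?v ^ (m + 1 - 2 * k)" for k
  have summand: "D (Var T ^ (m + 1) * (Const (M_coeff m k) * ?u ^ (k + 1) * ?v ^ (m - 2 * k)))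
      = ?t * (f k + g k)" for k
  proof (cases "2 * k \<le> m")
    case True
    have "D (Var T ^ (m + 1) * (Const (M_coeff m k) * ?u ^ (k + 1) * ?v ^ (m - 2 * k)))
        = Const (M_coeff m k) * D (Var T ^ (m + 1) * (?u ^ (k + 1) * ?v ^ (m - 2 * k)))"
      unfolding formal_derivative_Const_mult[OF D, symmetric] by (simp only: mult_ac)
    moreover have "m + 1 - 2 * k = m - 2 * k + 1" and "m + 3 + 2 * k = m + 1 + 2 * (k + 1)"
      using True by simp_all
    ultimately show ?thesis
      unfolding f_def g_def D_monomial Const_mult Const_of_nat
      by (simp only: distrib_left mult_ac add.assoc one_add_one)
  next
    \<comment> \<open>Here \<open>M_coeff m k\<close> is zero, so the truncated exponents do not
      matter.\<close>
    case False
    then show ?thesis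
      using formal_derivative_Const[OF D, of 0] by (simp add: f_def g_def M_coeff_eq_0)
  qed
  \<comment> \<open>Hitting v raises the power of u by one and lowers that of v by one, so
    \<open>g k\<close> carries the same monomial as \<open>f (Suc k)\<close>.\<close>
  have shift: "f (Suc k) + g k = h (Suc k)" for k
  proof -
    have "m + 3 + 2 * Suc k = m + 5 + 2 * k" and "m + 1 - 2 * Suc k = m - 2 * k - 1"
      by simp_all
    then show ?thesis
      unfolding f_def g_def h_def
      using M_coeff_Suc_Suc[of m k]
      by (simp add: Const_add distrib_right)
  qed
  \<comment> \<open>This allows the sum of \<open>f\<close> to run one index further, so that
    splitting off \<open>f 0\<close> leaves a range matching that of \<open>g\<close>.\<close>
  have "f (Suc m) = 0"
    by (simp add: f_def M_coeff_eq_0)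
  then have "(\<Sum>k\<le>m. f k + g k) = (\<Sum>k\<le>Suc m. f k) + (\<Sum>k\<le>m. g k)"
    by (simp add: sum.distrib)
  also have "\<dots> = f 0 + (\<Sum>k\<le>m. f (Suc k) + g k)"
    by (simp only: sum.atMost_Suc_shift sum.distrib add.assoc)
  also have "f 0 = h 0"
    by (simp add: f_def h_def)
  also have "h 0 + (\<Sum>k\<le>m. f (Suc k) + g k) = (\<Sum>k\<le>Suc m. h k)"
    by (simp only: shift sum.atMost_Suc_shift)
  also have "\<dots> = of_nat (m + 3) * M (m + 1) ?u ?v"
    unfolding M_eq_sum_M_coeff[OF order.refl] h_def Const_mult Const_of_nat
    by (simp only: sum_distrib_left mult.assoc Suc_eq_plus1)
  finally have "(\<Sum>k\<le>m. f k + g k) = of_nat (m + 3) * M (m + 1) ?u ?v" .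
  moreover have "D (Var T ^ (m + 1) * M m ?u ?v) = ?t * (\<Sum>k\<le>m. f k + g k)"
    unfolding M_eq_sum_M_coeff[OF order.refl] sum_distrib_left
      formal_derivative_sum[OF D] summand ..
  ultimately show ?thesis by (simp only: mult_ac)
qed

end

theorem theorem1p22:
  fixes D :: "tuv rat_mpoly \<Rightarrow> tuv rat_mpoly" and n :: nat
  assumes "formal_derivative grammar D"
    and "n \<ge> 1"
  shows "(D ^^ n) (Const (1 / 2) * Var V)
    = fact (n + 1) * Var T ^ n * M (n - 1) (Var U) (Var V)"
  using assms(2)
proof (induction n rule: dec_induct)
  case base
  have "D (Const (1 / 2) * Var V) = Const (1 / 2) * (Const 4 * (Var T * Var U))"
    by (simp add: formal_derivative_Const_mult[OF assms(1)] formal_derivative_Var[OF assms(1)]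
        mult.assoc)
  also have "\<dots> = Const 2 * (Var T * Var U)"
    unfolding mult.assoc[symmetric] Const_mult[symmetric] by simp
  finally show ?case
    by (simp add: M_def catalan_def mult.assoc)
next
  case (step n)
  obtain m where n: "n = m + 1"
    using le_Suc_ex[OF step.hyps(1)] by (metis add.commute)
  let ?M = "\<lambda>m. M m (Var U) (Var V)"
  have "(D ^^ Suc n) (Const (1 / 2) * Var V) = D (Const (fact (m + 2)) * (Var T ^ (m + 1) * ?M m))"
    using step.IH by (simp add: n Const_fact mult.assoc del: fact_Suc)
  also have "\<dots> = Const (fact (m + 2)) * (of_nat (m + 3) * Var T ^ (m + 2) * ?M (m + 1))"
    by (simp only: formal_derivative_Const_mult[OF assms(1)] D_power_times_M[OF assms(1)])
  \<comment> \<open>The factor m + 3 from \<open>D_power_times_M\<close> is exactly what advances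
    the factorial.\<close>
  also have "\<dots> = Const (fact (m + 3)) * Var T ^ (m + 2) * ?M (m + 1)"
  proof -
    have "fact (m + 3) = fact (m + 2) * (of_nat (m + 3) :: rat)"
      by (simp add: numeral_eq_Suc)
    then show ?thesis
      by (simp only: Const_mult Const_of_nat mult.assoc)
  qed
  finally show ?case
    by (simp add: n Const_fact numeral_eq_Suc del: fact_Suc)
qed

end
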